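(* There is no translation from $\pi^{\mathcal P}_A$ to CCS that is valid up to strong reduction bisimilarity $\leftrightarrow_r$. That is, there is no function $\mathcal T$ from $\pi^{\mathcal P}_A$ processes to CCS processes that is compositional and satisfies $\mathcal T(P)\leftrightarrow_r P$ for every $\pi^{\mathcal P}_A$ process $P$.
   Context: $\pi^{\mathcal P}_A$ is the fragment of the $\pi$-calculus (over an infinite name set) whose processes are built from $\mathbf 0$, prefixes $\tau.P$, $\bar xy.P$, $x(y).P$ (binding $y$), and parallel composition $P|Q$ only (no choice, recursion, matching or restriction); its reductions are the $\tau$-transitions of the standard $\pi$-calculus operational semantics (e.g. $\bar xv\mid x(y).P\xrightarrow{\tau}\mathbf 0\mid P\{v/y\}$). CCS is Milner's calculus with prefixing $\alpha.E$, arbitrary sums $\sum_{i\in I}E_i$, parallel composition $E|F$ (handshake communication of $a$ and $\bar a$ into $\tau$), restriction $E\backslash L$, relabelling $E[f]$ and agent identifiers with defining equations, with its standard operational semantics; its reductions are its $\tau$-transitions. An $n$-ary CCS context is a CCS expression possibly containing variables (holes) $X_1,\dots,X_n$, and $C[P_1,\dots,P_n]$ denotes the result of substituting $P_i$ for $X_i$. A translation $\mathcal T$ is compositional if for each $n$-ary operator $g$ of $\pi^{\mathcal P}_A$ (the constant $\mathbf 0$, each unary prefix operator $\tau.$, $\bar xy.$, $x(y).$ for names $x,y$, and the binary $|$) there is an $n$-ary CCS context $C_g$ with $\mathcal T(g(P_1,\dots,P_n))=C_g[\mathcal T(P_1),\dots,\mathcal T(P_n)]$. Strong reduction bisimilarity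 $\leftrightarrow_r$ (on the disjoint union of the two reduction systems) is the largest symmetric relation $\mathcal R$ such that $P\mathcal RQ$ and $P\xrightarrow{\tau}P'$ imply $Q\xrightarrow{\tau}Q'$ for some $Q'$ with $P'\mathcal RQ'$. *)

theory Defs
  imports Main
begin

section \<open>The fragment of the \<open>\<pi>\<close>-calculus\<close>

text \<open>Processes are raw terms: \<open>\<alpha>\<close>-convertible processes are not identified.\<close>

datatype 'n pi =
    PNil
  | PTau "'n pi"
  | POut 'n 'n "'n pi"
  | PIn 'n 'n "'n pi"
  | PPar "'n pi" "'n pi"

primrec fn :: "'n pi \<Rightarrow> 'n set" where
  "fn PNil = {}"
| "fn (PTau P) = fn P"
| "fn (POut x y P) = {x, y} \<union> fn P"
| "fn (PIn x y P) = {x} \<union> (fn P - {y})"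
| "fn (PPar P Q) = fn P \<union> fn Q"

text \<open>
  Simultaneous capture-avoiding substitution.  The bound name \<open>y\<close> of \<open>x(y).P\<close> is kept if it
  captures none of the substituted names, and is changed to a fresh name otherwise; a fresh
  name exists whenever the type of names is infinite.
\<close>

definition pick_bound :: "'n set \<Rightarrow> 'n \<Rightarrow> 'n" where
  "pick_bound S y = (if y \<notin> S then y else (SOME z. z \<notin> S))"

primrec psubst :: "'n pi \<Rightarrow> ('n \<Rightarrow> 'n) \<Rightarrow> 'n pi" where
  "psubst PNil \<sigma> = PNil"
| "psubst (PTau P) \<sigma> = PTau (psubst P \<sigma>)"
| "psubst (POut x y P) \<sigma> = POut (\<sigma> x) (\<sigma> y) (psubst P \<sigma>)"
| "psubst (PIn x y P) \<sigma> =
     (let z = pick_bound (\<sigma> ` (fn P - {y})) y in PIn (\<sigma> x) z (psubst P (\<sigma>(y := z))))"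
| "psubst (PPar P Q) \<sigma> = PPar (psubst P \<sigma>) (psubst Q \<sigma>)"

text \<open>
  Early semantics.  Since there is no restriction operator, all outputs are free, and the rules
  for opening and closing scopes as well as the side condition on bound names for parallel
  composition disappear.
\<close>

datatype 'n pi_act = PiTau | PiOut 'n 'n | PiIn 'n 'n

inductive pi_trans :: "'n pi \<Rightarrow> 'n pi_act \<Rightarrow> 'n pi \<Rightarrow> bool" where
  pi_tau: "pi_trans (PTau P) PiTau P"
| pi_out: "pi_trans (POut x y P) (PiOut x y) P"
| pi_in: "pi_trans (PIn x y P) (PiIn x v) (psubst P (id(y := v)))"
| pi_parL: "pi_trans P \<alpha> P' \<Longrightarrow> pi_trans (PPar P Q) \<alpha> (PPar P' Q)"
| pi_parR: "pi_trans Q \<alpha> Q' \<Longrightarrow> pi_trans (PPar P Q) \<alpha> (PPar P Q')"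
| pi_comL: "pi_trans P (PiOut x v) P' \<Longrightarrow> pi_trans Q (PiIn x v) Q'
    \<Longrightarrow> pi_trans (PPar P Q) PiTau (PPar P' Q')"
| pi_comR: "pi_trans P (PiIn x v) P' \<Longrightarrow> pi_trans Q (PiOut x v) Q'
    \<Longrightarrow> pi_trans (PPar P Q) PiTau (PPar P' Q')"

section \<open>CCS\<close>

datatype 'a label = Name 'a | CoName 'a

primrec co :: "'a label \<Rightarrow> 'a label" where
  "co (Name a) = CoName a"
| "co (CoName a) = Name a"

datatype 'a act = Tau | Vis "'a label"

typedef 'a relabelling = "{f :: 'a label \<Rightarrow> 'a label. \<forall>l. f (co l) = co (f l)}"
  morphisms relabel Relabelling
  by (rule exI[of _ "\<lambda>l. l"]) simp

primrec relabel_act :: "'a relabelling \<Rightarrow> 'a act \<Rightarrow> 'a act" where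
  "relabel_act f Tau = Tau"
| "relabel_act f (Vis l) = Vis (relabel f l)"

text \<open>
  CCS expressions over names \<open>'a\<close> and agent identifiers \<open>'k\<close>; \<open>CHole i\<close> is the
  variable \<open>X\<^sub>i\<close>, counting from 0.  In \<open>CSum F\<close>, the index set of the sum is \<open>dom F\<close>, which may be
  any subset of the type \<open>'i\<close>.  Arbitrary index sets are covered by leaving \<open>'i\<close> polymorphic.
\<close>

datatype ('a, 'k, 'i) ccs =
    CHole nat
  | CPre "'a act" "('a, 'k, 'i) ccs"
  | CSum "'i \<Rightarrow> ('a, 'k, 'i) ccs option"
  | CPar "('a, 'k, 'i) ccs" "('a, 'k, 'i) ccs"
  | CRes "('a, 'k, 'i) ccs" "'a label set"
  | CRel "('a, 'k, 'i) ccs" "'a relabelling"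
  | CId 'k

inductive ccs_context :: "nat \<Rightarrow> ('a, 'k, 'i) ccs \<Rightarrow> bool" for n where
  "i < n \<Longrightarrow> ccs_context n (CHole i)"
| "ccs_context n E \<Longrightarrow> ccs_context n (CPre \<alpha> E)"
| "(\<And>i E. F i = Some E \<Longrightarrow> ccs_context n E) \<Longrightarrow> ccs_context n (CSum F)"
| "ccs_context n E \<Longrightarrow> ccs_context n F \<Longrightarrow> ccs_context n (CPar E F)"
| "ccs_context n E \<Longrightarrow> ccs_context n (CRes E L)"
| "ccs_context n E \<Longrightarrow> ccs_context n (CRel E f)"
| "ccs_context n (CId A)"

abbreviation ccs_process :: "('a, 'k, 'i) ccs \<Rightarrow> bool" where
  "ccs_process \<equiv> ccs_context 0"

primrec fill :: "('a, 'k, 'i) ccs list \<Rightarrow> ('a, 'k, 'i) ccs \<Rightarrow> ('a, 'k, 'i) ccs" where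
  "fill Ps (CHole i) = (if i < length Ps then Ps ! i else CHole i)"
| "fill Ps (CPre \<alpha> E) = CPre \<alpha> (fill Ps E)"
| "fill Ps (CSum F) = CSum (\<lambda>i. map_option (fill Ps) (F i))"
| "fill Ps (CPar E F) = CPar (fill Ps E) (fill Ps F)"
| "fill Ps (CRes E L) = CRes (fill Ps E) L"
| "fill Ps (CRel E f) = CRel (fill Ps E) f"
| "fill Ps (CId A) = CId A"

text \<open>\<open>\<Delta> A\<close> is the right-hand side of the defining equation of the agent identifier \<open>A\<close>.\<close>

inductive ccs_trans ::
  "('k \<Rightarrow> ('a, 'k, 'i) ccs) \<Rightarrow> ('a, 'k, 'i) ccs \<Rightarrow> 'a act \<Rightarrow> ('a, 'k, 'i) ccs \<Rightarrow> bool"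
  for \<Delta> where
  ccs_pre: "ccs_trans \<Delta> (CPre \<alpha> E) \<alpha> E"
| ccs_sum: "F i = Some E \<Longrightarrow> ccs_trans \<Delta> E \<alpha> E' \<Longrightarrow> ccs_trans \<Delta> (CSum F) \<alpha> E'"
| ccs_parL: "ccs_trans \<Delta> E \<alpha> E' \<Longrightarrow> ccs_trans \<Delta> (CPar E F) \<alpha> (CPar E' F)"
| ccs_parR: "ccs_trans \<Delta> F \<alpha> F' \<Longrightarrow> ccs_trans \<Delta> (CPar E F) \<alpha> (CPar E F')"
| ccs_com: "ccs_trans \<Delta> E (Vis l) E' \<Longrightarrow> ccs_trans \<Delta> F (Vis (co l)) F'
    \<Longrightarrow> ccs_trans \<Delta> (CPar E F) Tau (CPar E' F')"
| ccs_res: "ccs_trans \<Delta> E \<alpha> E' \<Longrightarrow> (\<And>l. \<alpha> = Vis l \<Longrightarrow> l \<notin> L \<and> co l \<notin> L)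
    \<Longrightarrow> ccs_trans \<Delta> (CRes E L) \<alpha> (CRes E' L)"
| ccs_rel: "ccs_trans \<Delta> E \<alpha> E' \<Longrightarrow> ccs_trans \<Delta> (CRel E f) (relabel_act f \<alpha>) (CRel E' f)"
| ccs_id: "ccs_trans \<Delta> (\<Delta> A) \<alpha> E' \<Longrightarrow> ccs_trans \<Delta> (CId A) \<alpha> E'"

section \<open>Strong reduction bisimilarity\<close>

definition reduction_bisimulation :: "('s \<Rightarrow> 's \<Rightarrow> bool) \<Rightarrow> ('s \<Rightarrow> 's \<Rightarrow> bool) \<Rightarrow> bool" where
  "reduction_bisimulation red R \<longleftrightarrow>
     symp R \<and> (\<forall>P Q P'. R P Q \<longrightarrow> red P P' \<longrightarrow> (\<exists>Q'. red Q Q' \<and> R P' Q'))"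

definition reduction_bisimilar :: "('s \<Rightarrow> 's \<Rightarrow> bool) \<Rightarrow> 's \<Rightarrow> 's \<Rightarrow> bool" where
  "reduction_bisimilar red P Q \<longleftrightarrow> (\<exists>R. reduction_bisimulation red R \<and> R P Q)"

text \<open>
  The disjoint union of the two reduction systems.  It also contains CCS expressions with free
  variables as states; these are unreachable from processes when all defining equations are
  closed, so they do not affect bisimilarity of processes.
\<close>

inductive red :: "('k \<Rightarrow> ('a, 'k, 'i) ccs) \<Rightarrow>
    ('a, 'k, 'i) ccs + 'n pi \<Rightarrow> ('a, 'k, 'i) ccs + 'n pi \<Rightarrow> bool" for \<Delta> where
  "ccs_trans \<Delta> E Tau E' \<Longrightarrow> red \<Delta> (Inl E) (Inl E')"
| "pi_trans P PiTau P' \<Longrightarrow> red \<Delta> (Inr P) (Inr P')"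

section \<open>Translations\<close>

definition compositional :: "('n pi \<Rightarrow> ('a, 'k, 'i) ccs) \<Rightarrow> bool" where
  "compositional T \<longleftrightarrow>
     (\<exists>C. ccs_context 0 C \<and> T PNil = fill [] C) \<and>
     (\<exists>C. ccs_context 1 C \<and> (\<forall>P. T (PTau P) = fill [T P] C)) \<and>
     (\<forall>x y. \<exists>C. ccs_context 1 C \<and> (\<forall>P. T (POut x y P) = fill [T P] C)) \<and>
     (\<forall>x y. \<exists>C. ccs_context 1 C \<and> (\<forall>P. T (PIn x y P) = fill [T P] C)) \<and>
     (\<exists>C. ccs_context 2 C \<and> (\<forall>P Q. T (PPar P Q) = fill [T P, T Q] C))"

definition valid_up_to_reduction_bisimilarity ::
  "('k \<Rightarrow> ('a, 'k, 'i) ccs) \<Rightarrow> ('n pi \<Rightarrow> ('a, 'k, 'i) ccs) \<Rightarrow> bool" where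
  "valid_up_to_reduction_bisimilarity \<Delta> T \<longleftrightarrow>
     compositional T \<and> (\<forall>P. reduction_bisimilar (red \<Delta>) (Inl (T P)) (Inr P))"

end

theory Submission
  imports Defs
begin

text \<open>
  The hole of the context for the prefix \<open>x(y)\<close> is guarded, as otherwise \<open>x(y).\<tau>\<close> could reduce.
  Hence the first reduction of the translation of \<open>\<bar>xv | x(y).P\<close> does not involve the translation
  of \<open>P\<close>, and leads to \<open>D[T(P)]\<close> for one unary context \<open>D\<close> that works for every \<open>P\<close>, so that
  \<open>D[T(P)]\<close> is bisimilar to \<open>P{v/y}\<close>.  Take \<open>P = \<bar>yv | v(v)\<close> with \<open>y \<noteq> v\<close>.  It does not reduce, but
  \<open>P{v/y}\<close> does, so \<open>D[T(P)]\<close> reduces thanks to visible actions of \<open>T(P)\<close>. If only one such action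
  is used, it stems from one component of \<open>P\<close>, and the other one may be replaced by \<open>0\<close>, which is
  absurd.  Hence two copies of the hole of \<open>D\<close> communicate.  These copies are both active, and
  so \<open>D[T(\<tau>)]\<close> can reduce twice in a row, whereas \<open>\<tau>{v/y}\<close> cannot.
\<close>

section \<open>Transitions of CCS contexts\<close>

inductive_cases ccs_hole_E: "ccs_trans \<Delta> (CHole i) \<alpha> R"
inductive_cases ccs_pre_E: "ccs_trans \<Delta> (CPre \<beta> E) \<alpha> R"
inductive_cases ccs_sum_E: "ccs_trans \<Delta> (CSum F) \<alpha> R"
inductive_cases ccs_par_E: "ccs_trans \<Delta> (CPar E F) \<alpha> R"
inductive_cases ccs_res_E: "ccs_trans \<Delta> (CRes E L) \<alpha> R"
inductive_cases ccs_rel_E: "ccs_trans \<Delta> (CRel E f) \<alpha> R"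

text \<open>Dropping the residual turns the operational rules into equations,
  \<open>can_simps\<close>, so that inductions over contexts need not track residuals.\<close>

definition can :: "('k \<Rightarrow> ('a, 'k, 'i) ccs) \<Rightarrow> ('a, 'k, 'i) ccs \<Rightarrow> 'a act \<Rightarrow> bool" where
  "can \<Delta> E \<alpha> \<longleftrightarrow> (\<exists>R. ccs_trans \<Delta> E \<alpha> R)"

text \<open>Detects two active copies of a hole: if the filling reduces, each copy can contribute
  one reduction.\<close>

definition can2 :: "('k \<Rightarrow> ('a, 'k, 'i) ccs) \<Rightarrow> ('a, 'k, 'i) ccs \<Rightarrow> bool" where
  "can2 \<Delta> E \<longleftrightarrow> (\<exists>R. ccs_trans \<Delta> E Tau R \<and> can \<Delta> R Tau)"

lemma can_hole: "\<not> can \<Delta> (CHole i) \<alpha>"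
  by (auto simp: can_def elim: ccs_hole_E)

lemma can_pre: "can \<Delta> (CPre \<beta> E) \<alpha> \<longleftrightarrow> \<alpha> = \<beta>"
  by (auto simp: can_def elim: ccs_pre_E intro: ccs_trans.intros)

lemma can_sum: "can \<Delta> (CSum F) \<alpha> \<longleftrightarrow> (\<exists>i E. F i = Some E \<and> can \<Delta> E \<alpha>)"
  unfolding can_def by (blast elim: ccs_sum_E intro: ccs_trans.intros)

lemma can_par: "can \<Delta> (CPar E F) \<alpha> \<longleftrightarrow> can \<Delta> E \<alpha> \<or> can \<Delta> F \<alpha> \<or>
    \<alpha> = Tau \<and> (\<exists>l. can \<Delta> E (Vis l) \<and> can \<Delta> F (Vis (co l)))"
  unfolding can_def by (blast elim: ccs_par_E intro: ccs_trans.intros)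

lemma can_res: "can \<Delta> (CRes E L) \<alpha> \<longleftrightarrow> can \<Delta> E \<alpha> \<and> (\<forall>l. \<alpha> = Vis l \<longrightarrow> l \<notin> L \<and> co l \<notin> L)"
  unfolding can_def by (blast elim: ccs_res_E intro: ccs_trans.intros)

lemma can_rel: "can \<Delta> (CRel E f) \<alpha> \<longleftrightarrow> (\<exists>\<beta>. \<alpha> = relabel_act f \<beta> \<and> can \<Delta> E \<beta>)"
  unfolding can_def by (blast elim: ccs_rel_E intro: ccs_trans.intros)

lemmas can_simps = can_hole can_pre can_sum can_par can_res can_rel

lemma can2_sum: "F i = Some E \<Longrightarrow> can2 \<Delta> E \<Longrightarrow> can2 \<Delta> (CSum F)"
  unfolding can2_def by (blast intro: ccs_trans.intros)

lemma can2_par: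
  "can2 \<Delta> E \<Longrightarrow> can2 \<Delta> (CPar E F)"
  "can2 \<Delta> F \<Longrightarrow> can2 \<Delta> (CPar E F)"
  "can \<Delta> E Tau \<Longrightarrow> can \<Delta> F Tau \<Longrightarrow> can2 \<Delta> (CPar E F)"
  unfolding can2_def can_def by (blast intro: ccs_trans.intros)+

lemma can2_res: "can2 \<Delta> E \<Longrightarrow> can2 \<Delta> (CRes E L)"
  unfolding can2_def can_def by (blast intro: ccs_trans.intros)

lemma ccs_rel_tau: "ccs_trans \<Delta> E Tau R \<Longrightarrow> ccs_trans \<Delta> (CRel E f) Tau (CRel R f)"
  using ccs_rel[of \<Delta> E Tau R f] by simp

lemma can2_rel: "can2 \<Delta> E \<Longrightarrow> can2 \<Delta> (CRel E f)"
  unfolding can2_def can_def by (blast intro: ccs_rel_tau)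

section \<open>Closedness, filling and guardedness of contexts\<close>

inductive_cases context_pre_E: "ccs_context n (CPre \<alpha> E)"
inductive_cases context_sum_E: "ccs_context n (CSum F)"
inductive_cases context_par_E: "ccs_context n (CPar E F)"
inductive_cases context_res_E: "ccs_context n (CRes E L)"
inductive_cases context_rel_E: "ccs_context n (CRel E f)"

lemma ccs_context_mono:
  assumes "ccs_context m E" "m \<le> n"
  shows "ccs_context n E"
  using assms by induction (auto intro: ccs_context.intros)

text \<open>Unfolding an identifier brings in only a closed expression, so a transition creates no
  new holes.\<close>

lemma ccs_context_trans:
  assumes "\<And>A. ccs_process (\<Delta> A)"
    and "ccs_trans \<Delta> E \<alpha> E'" "ccs_context n E"
  shows "ccs_context n E'"
  using assms(2,3)
proof induction
  case (ccs_id A \<alpha> E')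
  then show ?case using assms(1) ccs_context_mono by blast
qed (auto elim: context_pre_E context_sum_E context_par_E context_res_E context_rel_E
      intro: ccs_context.intros)

lemma fill_process:
  assumes "ccs_process E"
  shows "fill Ps E = E"
  using assms
proof induction
  case (3 F)
  have "map_option (fill Ps) (F i) = F i" for i
    using 3 by (cases "F i") auto
  then show ?case by simp
qed auto

lemma fill_fill:
  assumes "ccs_context (length Qs) E"
  shows "fill Ps (fill Qs E) = fill (map (fill Ps) Qs) E"
  using assms
proof induction
  case (3 F)
  have "map_option (fill Ps) (map_option (fill Qs) (F i))
      = map_option (fill (map (fill Ps) Qs)) (F i)" for i
    using 3 by (cases "F i") auto
  then show ?case by simp
qed auto

text \<open>Every hole lies below a prefix. Identifiers qualify because \<open>fill\<close> does not
  enter their defining expressions.\<close>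

inductive guarded :: "('a, 'k, 'i) ccs \<Rightarrow> bool" where
  guarded_pre: "guarded (CPre \<alpha> E)"
| guarded_sum: "(\<And>i E. F i = Some E \<Longrightarrow> guarded E) \<Longrightarrow> guarded (CSum F)"
| guarded_par: "guarded E \<Longrightarrow> guarded F \<Longrightarrow> guarded (CPar E F)"
| guarded_res: "guarded E \<Longrightarrow> guarded (CRes E L)"
| guarded_rel: "guarded E \<Longrightarrow> guarded (CRel E f)"
| guarded_id: "guarded (CId A)"

lemma guarded_process: "ccs_process E \<Longrightarrow> guarded E"
  by (induction rule: ccs_context.induct) (auto intro: guarded.intros)

lemma guarded_fill:
  assumes "ccs_context (length Ps) E" "\<And>P. P \<in> set Ps \<Longrightarrow> guarded P"
  shows "guarded (fill Ps E)"
  using assms(1) by induction (auto intro: guarded.intros assms(2))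

text \<open>Above an unguarded hole there are only sums, parallel compositions, restrictions and
  relabellings, none of which blocks \<open>Tau\<close>.\<close>

lemma not_guarded_can_tau:
  assumes "ccs_context 1 C" "\<not> guarded C" "can \<Delta> E Tau"
  shows "can \<Delta> (fill [E] C) Tau"
  using assms(1,2)
proof induction
  case (3 F)
  then obtain i G where "F i = Some G" "\<not> guarded G"
    by (blast intro: guarded.intros)
  with 3 show ?case by (fastforce simp: can_sum)
next
  case (6 C f)
  then have "can \<Delta> (fill [E] C) Tau" by (blast intro: guarded.intros)
  then show ?case by (force simp: can_rel intro: exI[of _ Tau])
qed (auto simp: can_simps assms(3) intro: guarded.intros)

text \<open>The derivation of the transition never inspects a filled hole; \<open>D\<close> is the
  residual with its holes kept.\<close>

lemma guarded_trans_uniform: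
  assumes "\<And>A. ccs_process (\<Delta> A)"
    and "guarded G" "ccs_trans \<Delta> (fill [E] G) \<alpha> R"
  shows "\<exists>D. \<forall>F. ccs_trans \<Delta> (fill [F] G) \<alpha> (fill [F] D)"
  using assms(2,3)
proof (induction arbitrary: \<alpha> R)
  case (guarded_pre \<beta> G)
  then have "\<alpha> = \<beta>" by (auto elim: ccs_pre_E)
  then show ?case by (auto intro: ccs_trans.intros)
next
  case (guarded_sum S)
  then obtain i G where i: "S i = Some G" "ccs_trans \<Delta> (fill [E] G) \<alpha> R"
    by (auto elim!: ccs_sum_E)
  then obtain D where "\<forall>F. ccs_trans \<Delta> (fill [F] G) \<alpha> (fill [F] D)"
    using guarded_sum by blast
  with i(1) show ?case by (fastforce intro: ccs_trans.intros)
next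
  case (guarded_par G H)
  from guarded_par.prems consider R' where "ccs_trans \<Delta> (fill [E] G) \<alpha> R'"
    | R' where "ccs_trans \<Delta> (fill [E] H) \<alpha> R'"
    | l R1 R2 where "\<alpha> = Tau" "ccs_trans \<Delta> (fill [E] G) (Vis l) R1"
      "ccs_trans \<Delta> (fill [E] H) (Vis (co l)) R2"
    by (auto elim: ccs_par_E)
  then show ?case
  proof cases
    case (1 R')
    then obtain D where "\<forall>F. ccs_trans \<Delta> (fill [F] G) \<alpha> (fill [F] D)"
      using guarded_par by blast
    then show ?thesis by (auto intro!: exI[of _ "CPar D H"] ccs_trans.intros)
  next
    case (2 R')
    then obtain D where "\<forall>F. ccs_trans \<Delta> (fill [F] H) \<alpha> (fill [F] D)"
      using guarded_par by blast
    then show ?thesis by (auto intro!: exI[of _ "CPar G D"] ccs_trans.intros)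
  next
    case (3 l R1 R2)
    obtain D1 where "\<forall>F. ccs_trans \<Delta> (fill [F] G) (Vis l) (fill [F] D1)"
      using guarded_par 3 by blast
    moreover obtain D2 where "\<forall>F. ccs_trans \<Delta> (fill [F] H) (Vis (co l)) (fill [F] D2)"
      using guarded_par 3 by blast
    ultimately show ?thesis
      using \<open>\<alpha> = Tau\<close> by (auto intro!: exI[of _ "CPar D1 D2"] ccs_com)
  qed
next
  case (guarded_res G L)
  from guarded_res.prems obtain R' where R': "ccs_trans \<Delta> (fill [E] G) \<alpha> R'"
    and L: "\<And>l. \<alpha> = Vis l \<Longrightarrow> l \<notin> L \<and> co l \<notin> L"
    by (auto elim!: ccs_res_E)
  from R' obtain D where "\<forall>F. ccs_trans \<Delta> (fill [F] G) \<alpha> (fill [F] D)"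
    using guarded_res by blast
  with L show ?case by (auto intro!: exI[of _ "CRes D L"] ccs_trans.intros)
next
  case (guarded_rel G f)
  from guarded_rel.prems obtain R' \<beta> where R': "ccs_trans \<Delta> (fill [E] G) \<beta> R'"
    and \<alpha>: "\<alpha> = relabel_act f \<beta>"
    by (auto elim!: ccs_rel_E)
  from R' obtain D where "\<forall>F. ccs_trans \<Delta> (fill [F] G) \<beta> (fill [F] D)"
    using guarded_rel by blast
  with \<alpha> show ?case by (auto intro!: exI[of _ "CRel D f"] ccs_trans.intros)
next
  case (guarded_id A)
  then have *: "ccs_trans \<Delta> (CId A) \<alpha> R" by simp
  \<comment> \<open>A closed residual is unchanged by filling, so \<open>R\<close> itself serves as
    \<open>D\<close>.\<close>
  then have "ccs_process R"
    by (rule ccs_context_trans[of \<Delta>, OF assms(1)]) (rule ccs_context.intros)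
  with * show ?case by (auto simp: fill_process intro!: exI[of _ R])
qed

text \<open>
  The alternatives are that no copy of the hole takes part in the transition, that one does,
  and that two do; the third only arises from a communication.
\<close>

lemma fill_can_cases:
  assumes "can \<Delta> (fill [E] D) \<alpha>"
  shows "(\<forall>F. can \<Delta> (fill [F] D) \<alpha>) \<or>
    (\<exists>\<beta>. can \<Delta> E \<beta> \<and> (\<forall>F. can \<Delta> F \<beta> \<longrightarrow> can \<Delta> (fill [F] D) \<alpha>) \<and>
       (\<forall>F. can \<Delta> F Tau \<longrightarrow> can \<Delta> (fill [F] D) Tau)) \<or>
    (\<forall>F. can \<Delta> F Tau \<longrightarrow> can2 \<Delta> (fill [F] D))"
    (is "?none D \<alpha> \<or> ?one D \<alpha> \<or> ?two D")
  using assms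
proof (induction D arbitrary: \<alpha>)
  case (CHole i)
  then show ?case by (cases i) (auto simp: can_hole)
next
  case (CPre \<gamma> D)
  then show ?case by (auto simp: can_pre)
next
  case (CSum S)
  then obtain i D where i: "S i = Some D" and D: "can \<Delta> (fill [E] D) \<alpha>"
    by (auto simp: can_sum)
  have "?none D \<alpha> \<or> ?one D \<alpha> \<or> ?two D"
    using CSum.IH[of "Some D" D] i D by (metis option.set_intros rangeI)
  moreover have "can \<Delta> (fill [F] D) \<gamma> \<Longrightarrow> can \<Delta> (fill [F] (CSum S)) \<gamma>" for F \<gamma>
    using i by (auto simp: can_sum)
  moreover have "can2 \<Delta> (fill [F] D) \<Longrightarrow> can2 \<Delta> (fill [F] (CSum S))" for F
    using i by (auto intro: can2_sum)
  ultimately show ?case by meson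
next
  case (CPar D1 D2)
  have lift: "can \<Delta> (fill [F] D1) \<gamma> \<Longrightarrow> can \<Delta> (fill [F] (CPar D1 D2)) \<gamma>"
    "can \<Delta> (fill [F] D2) \<gamma> \<Longrightarrow> can \<Delta> (fill [F] (CPar D1 D2)) \<gamma>"
    "can2 \<Delta> (fill [F] D1) \<Longrightarrow> can2 \<Delta> (fill [F] (CPar D1 D2))"
    "can2 \<Delta> (fill [F] D2) \<Longrightarrow> can2 \<Delta> (fill [F] (CPar D1 D2))" for F \<gamma>
    by (auto simp: can_par intro: can2_par)
  from CPar.prems consider "can \<Delta> (fill [E] D1) \<alpha>" | "can \<Delta> (fill [E] D2) \<alpha>"
    | l where "\<alpha> = Tau" "can \<Delta> (fill [E] D1) (Vis l)" "can \<Delta> (fill [E] D2) (Vis (co l))"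
    by (auto simp: can_par)
  then show ?case
  proof cases
    case 1
    from CPar.IH(1)[OF 1] lift show ?thesis by meson
  next
    case 2
    from CPar.IH(2)[OF 2] lift show ?thesis by meson
  next
    case (3 l)
    have com: "can \<Delta> (fill [F] (CPar D1 D2)) \<alpha>"
      if "can \<Delta> (fill [F] D1) (Vis l)" "can \<Delta> (fill [F] D2) (Vis (co l))" for F
      using that 3(1) by (auto simp: can_par)
    \<comment> \<open>In the last case below, the second clause of \<open>?one\<close> supplies both
      premises: each component has an active copy of the hole, and the reductions of the two copies
      can be performed one after the other.\<close>
    have two: "can2 \<Delta> (fill [F] (CPar D1 D2))"
      if "can \<Delta> (fill [F] D1) Tau" "can \<Delta> (fill [F] D2) Tau" for F
      using that by (auto intro: can2_par)
    from CPar.IH(1)[OF 3(2)] CPar.IH(2)[OF 3(3)]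
    consider "?two D1" | "?two D2" | "?none D1 (Vis l)" "?none D2 (Vis (co l))"
      | "?none D1 (Vis l)" "?one D2 (Vis (co l))"
      | "?one D1 (Vis l)" "?none D2 (Vis (co l))"
      | "?one D1 (Vis l)" "?one D2 (Vis (co l))"
      by argo
    then show ?thesis
    proof cases
      case 1 then show ?thesis using lift by meson
    next
      case 2 then show ?thesis using lift by meson
    next
      case 3 then show ?thesis using com by meson
    next
      \<comment> \<open>\<open>D1\<close> offers \<open>l\<close> whatever is filled in, so the copy
        in \<open>D2\<close> is the only one that matters; the next case is symmetric.\<close>
      case 4 then show ?thesis using com lift by meson
    next
      case 5 then show ?thesis using com lift by meson
    next
      case 6 then show ?thesis using two by meson
    qed
  qed
next
  case (CRes D L)
  then have "can \<Delta> (fill [E] D) \<alpha>" and L: "\<forall>l. \<alpha> = Vis l \<longrightarrow> l \<notin> L \<and> co l \<notin> L"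
    by (auto simp: can_res)
  from CRes.IH[OF this(1)] have "?none D \<alpha> \<or> ?one D \<alpha> \<or> ?two D" .
  moreover have "can \<Delta> (fill [F] D) \<alpha> \<Longrightarrow> can \<Delta> (fill [F] (CRes D L)) \<alpha>"
    "can \<Delta> (fill [F] D) Tau \<Longrightarrow> can \<Delta> (fill [F] (CRes D L)) Tau"
    "can2 \<Delta> (fill [F] D) \<Longrightarrow> can2 \<Delta> (fill [F] (CRes D L))" for F
    using L by (auto simp: can_res intro: can2_res)
  ultimately show ?case by meson
next
  case (CRel D f)
  then obtain \<beta> where "can \<Delta> (fill [E] D) \<beta>" and \<alpha>: "\<alpha> = relabel_act f \<beta>"
    by (auto simp: can_rel)
  from CRel.IH[OF this(1)] have "?none D \<beta> \<or> ?one D \<beta> \<or> ?two D" .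
  moreover have "can \<Delta> (fill [F] D) \<beta> \<Longrightarrow> can \<Delta> (fill [F] (CRel D f)) \<alpha>"
    "can2 \<Delta> (fill [F] D) \<Longrightarrow> can2 \<Delta> (fill [F] (CRel D f))" for F
    using \<alpha> by (auto simp: can_rel intro: can2_rel)
  moreover have "can \<Delta> (fill [F] D) Tau \<Longrightarrow> can \<Delta> (fill [F] (CRel D f)) Tau" for F
    by (force simp: can_rel intro: exI[of _ Tau])
  ultimately show ?case by meson
next
  case (CId A)
  then show ?case by auto
qed

text \<open>A visible transition is not a communication, so it involves at most one of the two holes.\<close>

lemma fill_can_visible:
  assumes "can \<Delta> (fill [E1, E2] C) (Vis l)"
  shows "(\<forall>F. can \<Delta> (fill [E1, F] C) (Vis l)) \<or> (\<forall>F. can \<Delta> (fill [F, E2] C) (Vis l))"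
  using assms
proof (induction C arbitrary: l)
  case (CHole i)
  then show ?case by (cases i) (auto simp: nth_Cons split: nat.splits if_splits)
next
  case (CSum S)
  then obtain i D where i: "S i = Some D" and D: "can \<Delta> (fill [E1, E2] D) (Vis l)"
    by (auto simp: can_sum)
  have "(\<forall>F. can \<Delta> (fill [E1, F] D) (Vis l)) \<or> (\<forall>F. can \<Delta> (fill [F, E2] D) (Vis l))"
    using CSum.IH[of "Some D" D] i D by (metis option.set_intros rangeI)
  moreover have "can \<Delta> (fill Es D) (Vis l) \<Longrightarrow> can \<Delta> (fill Es (CSum S)) (Vis l)" for Es
    using i by (auto simp: can_sum)
  ultimately show ?case by meson
next
  case (CPar C1 C2)
  then consider "can \<Delta> (fill [E1, E2] C1) (Vis l)" | "can \<Delta> (fill [E1, E2] C2) (Vis l)"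
    by (auto simp: can_par)
  then show ?case
  proof cases
    case 1
    from CPar.IH(1)[OF this] show ?thesis by (auto simp: can_par)
  next
    case 2
    from CPar.IH(2)[OF this] show ?thesis by (auto simp: can_par)
  qed
next
  case (CRel C f)
  then obtain \<beta> where \<beta>: "can \<Delta> (fill [E1, E2] C) \<beta>" "Vis l = relabel_act f \<beta>"
    by (auto simp: can_rel)
  \<comment> \<open>Relabelling fixes \<open>Tau\<close>, so a visible image has a visible source
    and the induction hypothesis applies.\<close>
  then obtain m where "\<beta> = Vis m" by (cases \<beta>) auto
  with \<beta>(1) CRel.IH
  have "(\<forall>F. can \<Delta> (fill [E1, F] C) \<beta>) \<or> (\<forall>F. can \<Delta> (fill [F, E2] C) \<beta>)" by blast
  moreover have "can \<Delta> (fill Es C) \<beta> \<Longrightarrow> can \<Delta> (fill Es (CRel C f)) (Vis l)" for Es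
    using \<beta>(2) by (auto simp: can_rel)
  ultimately show ?case by meson
qed (auto simp: can_simps)

section \<open>Reductions in the \<open>\<pi>\<close>-calculus\<close>

inductive_cases pi_nil_E: "pi_trans PNil \<alpha> Q"
inductive_cases pi_tau_E: "pi_trans (PTau P) \<alpha> Q"
inductive_cases pi_out_E: "pi_trans (POut x y P) \<alpha> Q"
inductive_cases pi_in_E: "pi_trans (PIn x y P) \<alpha> Q"
inductive_cases pi_par_E: "pi_trans (PPar P R) \<alpha> Q"

lemmas pi_elims = pi_nil_E pi_tau_E pi_out_E pi_in_E pi_par_E

text \<open>Each side has only a visible prefix to offer, so their communication is the sole
  reduction. This determinism fixes which process a bisimilar reduct must match.\<close>

lemma pi_send_receive_iff:
  "pi_trans (PPar (POut x v P) (PIn x y Q)) PiTau R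
     \<longleftrightarrow> R = PPar P (psubst Q (id(y := v)))"
  (is "?red \<longleftrightarrow> ?R")
proof
  show "?red \<Longrightarrow> ?R" by (auto elim!: pi_elims)
  show "?R \<Longrightarrow> ?red" by (simp add: pi_comL[OF pi_out pi_in])
qed

section \<open>Reduction bisimilarity\<close>

lemma reduction_bisimilar_sym:
  "reduction_bisimilar r p q \<Longrightarrow> reduction_bisimilar r q p"
  unfolding reduction_bisimilar_def reduction_bisimulation_def by (blast dest: sympD)

lemma reduction_bisimilar_step:
  "reduction_bisimilar r p q \<Longrightarrow> r p p' \<Longrightarrow> \<exists>q'. r q q' \<and> reduction_bisimilar r p' q'"
  unfolding reduction_bisimilar_def reduction_bisimulation_def by metis

inductive_cases red_Inl_E: "red \<Delta> (Inl E) s"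
inductive_cases red_Inr_E: "red \<Delta> (Inr P) s"

abbreviation matches ::
  "('k \<Rightarrow> ('a, 'k, 'i) ccs) \<Rightarrow> ('a, 'k, 'i) ccs \<Rightarrow> 'n pi \<Rightarrow> bool" where
  "matches \<Delta> E P \<equiv> reduction_bisimilar (red \<Delta>) (Inl E) (Inr P)"

lemma matches_ccs_step:
  assumes "matches \<Delta> E P" "ccs_trans \<Delta> E Tau E'"
  shows "\<exists>P'. pi_trans P PiTau P' \<and> matches \<Delta> E' P'"
  using reduction_bisimilar_step[OF assms(1) red.intros(1)[OF assms(2)]]
  by (auto elim: red_Inr_E)

lemma matches_pi_step:
  assumes "matches \<Delta> E P" "pi_trans P PiTau P'"
  shows "\<exists>E'. ccs_trans \<Delta> E Tau E' \<and> matches \<Delta> E' P'"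
  using reduction_bisimilar_step[OF reduction_bisimilar_sym[OF assms(1)] red.intros(2)[OF assms(2)]]
  by (blast elim: red_Inl_E intro: reduction_bisimilar_sym)

text \<open>Lets reducibility of a CCS term be decided by inspecting the corresponding
  \<open>pi\<close> process.\<close>

lemma matches_can_iff:
  "matches \<Delta> E P \<Longrightarrow> can \<Delta> E Tau \<longleftrightarrow> (\<exists>P'. pi_trans P PiTau P')"
  unfolding can_def using matches_ccs_step matches_pi_step by metis

section \<open>The impossibility result\<close>

text \<open>Communication is the only way for a process to undergo a substitution. Guardedness makes
  the CCS residual of that step uniform in \<open>P\<close>.\<close>

lemma substitution_context:
  fixes T :: "'n pi \<Rightarrow> ('a, 'k, 'i) ccs"
  assumes \<Delta>: "\<And>A. ccs_process (\<Delta> A)"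
    and T: "\<And>P. ccs_process (T P)" "\<And>P. matches \<Delta> (T P) P"
    and Cin: "ccs_context 1 Cin" "\<And>P. T (PIn x y P) = fill [T P] Cin"
    and Cpar: "ccs_context 2 Cpar" "\<And>P Q. T (PPar P Q) = fill [T P, T Q] Cpar"
  obtains D where
    "\<And>P. matches \<Delta> (fill [T P] D) (PPar PNil (psubst P (id(y := v))))"
proof -
  let ?out = "POut x v PNil"
  \<comment> \<open>Only the prefix context \<open>Cin\<close> keeps a hole, so \<open>G\<close> is
    unary and its hole stands for \<open>T P\<close>.\<close>
  define G where "G = fill [T ?out, Cin] Cpar"
  have G: "fill [T P] G = T (PPar ?out (PIn x y P))" for P
    using Cpar by (simp add: G_def fill_fill numeral_2_eq_2 Cin(2) fill_process T(1))
  have "guarded Cin"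
  proof (rule ccontr)
    assume "\<not> guarded Cin"
    moreover have "can \<Delta> (T (PTau PNil)) Tau"
      using pi_tau by (simp add: matches_can_iff[OF T(2)]) blast
    ultimately have "can \<Delta> (T (PIn x y (PTau PNil))) Tau"
      unfolding Cin(2) by (rule not_guarded_can_tau[OF Cin(1)])
    then show False by (auto simp: matches_can_iff[OF T(2)] elim!: pi_elims)
  qed
  then have "guarded G"
    unfolding G_def using Cpar(1) guarded_process[OF T(1)]
    by (intro guarded_fill) (auto simp: numeral_2_eq_2)
  \<comment> \<open>\<open>PNil\<close> is an arbitrary choice: one transition of one instance
    yields \<open>D\<close> for all fillings.\<close>
  moreover obtain R where "ccs_trans \<Delta> (fill [T PNil] G) Tau R"
    unfolding G using matches_pi_step[OF T(2) pi_comL[OF pi_out pi_in]] by blast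
  ultimately obtain D where D: "ccs_trans \<Delta> (fill [F] G) Tau (fill [F] D)" for F
    using guarded_trans_uniform[OF \<Delta>] by meson
  have "matches \<Delta> (fill [T P] D) (PPar PNil (psubst P (id(y := v))))" for P
    using matches_ccs_step[OF T(2) D[of "T P", unfolded G]] by (auto simp: pi_send_receive_iff)
  then show thesis by (rule that)
qed

theorem theorem1:
  fixes \<Delta> :: "'k \<Rightarrow> ('a, 'k, 'i) ccs"
  assumes "infinite (UNIV :: 'n set)"
    and "\<And>A. ccs_process (\<Delta> A)"
  shows "\<not> (\<exists>T :: 'n pi \<Rightarrow> ('a, 'k, 'i) ccs.
           (\<forall>P. ccs_process (T P)) \<and> valid_up_to_reduction_bisimilarity \<Delta> T)"
proof
  assume "\<exists>T :: 'n pi \<Rightarrow> ('a, 'k, 'i) ccs.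
    (\<forall>P. ccs_process (T P)) \<and> valid_up_to_reduction_bisimilarity \<Delta> T"
  then obtain T :: "'n pi \<Rightarrow> ('a, 'k, 'i) ccs"
    where T: "\<And>P. ccs_process (T P)" "\<And>P. matches \<Delta> (T P) P" and comp: "compositional T"
    by (auto simp: valid_up_to_reduction_bisimilarity_def)
  \<comment> \<open>Distinct names keep the sender on \<open>y\<close> and the receiver on
    \<open>v\<close> apart until \<open>y\<close> is replaced by \<open>v\<close>.\<close>
  obtain y v :: 'n where "y \<noteq> v"
    using assms(1) by (metis UNIV_I finite.emptyI finite.insertI finite_subset insertCI subsetI)
  obtain Cin where Cin: "ccs_context 1 Cin" "\<And>P. T (PIn v y P) = fill [T P] Cin"
    using comp unfolding compositional_def by meson
  obtain Cpar where Cpar: "ccs_context 2 Cpar" "\<And>P Q. T (PPar P Q) = fill [T P, T Q] Cpar"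
    using comp unfolding compositional_def by meson
  obtain D where D: "\<And>P. matches \<Delta> (fill [T P] D) (PPar PNil (psubst P (id(y := v))))"
    using substitution_context[OF assms(2) T Cin Cpar] by blast
  define P1 P2 where "P1 = POut y v (PNil :: 'n pi)" and "P2 = PIn v v (PNil :: 'n pi)"
  let ?P = "PPar P1 P2"
  note P_defs = P1_def P2_def
  have "\<exists>Q. pi_trans (PPar PNil (psubst ?P (id(y := v)))) PiTau Q"
    unfolding P_defs psubst.simps Let_def fun_upd_apply id_apply if_cancel if_True simp_thms
    by (rule exI, rule pi_parR, rule pi_comL, rule pi_out, rule pi_in)
  then have "can \<Delta> (fill [T ?P] D) Tau"
    by (simp add: matches_can_iff[OF D])
  \<comment> \<open>Excludes the alternative of \<open>fill_can_cases\<close> in which no copy of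
    the hole takes part.\<close>
  moreover have "\<not> can \<Delta> (fill [T PNil] D) Tau"
    by (auto simp: matches_can_iff[OF D] elim!: pi_elims)
  \<comment> \<open>Excludes two active copies: \<open>PTau PNil\<close> is unaffected by the
    substitution and reduces only once, while its translation can do \<open>Tau\<close>.\<close>
  moreover have "\<not> can2 \<Delta> (fill [T (PTau PNil)] D)"
  proof
    assume "can2 \<Delta> (fill [T (PTau PNil)] D)"
    then obtain R where R: "ccs_trans \<Delta> (fill [T (PTau PNil)] D) Tau R" "can \<Delta> R Tau"
      by (auto simp: can2_def)
    then obtain P' where "pi_trans (PPar PNil (PTau (PNil :: 'n pi))) PiTau P'" "matches \<Delta> R P'"
      using matches_ccs_step[OF D R(1)] by auto
    with R(2) show False
      by (auto simp: matches_can_iff[OF \<open>matches \<Delta> R P'\<close>] elim!: pi_elims)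
  qed
  moreover have "can \<Delta> (T (PTau PNil)) Tau"
    using pi_tau by (simp add: matches_can_iff[OF T(2)]) blast
  ultimately obtain \<beta> where \<beta>: "can \<Delta> (T ?P) \<beta>"
    "\<And>F. can \<Delta> F \<beta> \<Longrightarrow> can \<Delta> (fill [F] D) Tau"
    using fill_can_cases[of \<Delta> "T ?P" D Tau] by blast
  \<comment> \<open>Before the substitution the channels differ, so the action
    \<open>\<beta>\<close> used by \<open>D\<close> must be visible.\<close>
  have "\<not> can \<Delta> (T ?P) Tau"
    using \<open>y \<noteq> v\<close> by (auto simp: matches_can_iff[OF T(2)] P_defs elim!: pi_elims)
  with \<beta>(1) obtain l where "\<beta> = Vis l" by (cases \<beta>) auto
  \<comment> \<open>Being visible, \<open>\<beta>\<close> survives the replacement of one component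
    by \<open>PNil\<close>. Then \<open>D\<close> would still reduce, although a lone sender or
    receiver cannot.\<close>
  then have "can \<Delta> (T (PPar P1 PNil)) \<beta> \<or> can \<Delta> (T (PPar PNil P2)) \<beta>"
    using \<beta>(1) fill_can_visible unfolding Cpar(2) by blast
  then have "can \<Delta> (fill [T (PPar P1 PNil)] D) Tau \<or> can \<Delta> (fill [T (PPar PNil P2)] D) Tau"
    using \<beta>(2) by blast
  then show False
    by (auto simp: matches_can_iff[OF D] P_defs Let_def elim!: pi_elims)
qed

end
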